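(* Let $G=(V,E)$ be a loopless multigraph with $m=|E|$ and let $\alpha:V\to\mathbb{N}$. The algorithm described in the context (Algorithm 2) outputs every $\alpha$-orientation of $G$ exactly once, with delay $O(m^2)$.
   Context: For an orientation $D$ of $G$ and $v\in V$, $\delta^+_D(v)$ is the outdegree of $v$. An $\alpha$-orientation is an orientation $D$ of $G$ with $\delta^+_D(v)=\alpha(v)$ for all $v\in V$. For a set $B$ of arcs, $D^B$ denotes $D$ with the arcs of $B$ reversed, and $a^-$ is the reverse of arc $a$. Procedure EnOPODS$(D,F)$ (with a fixed linear order on the edges of $G$; $D$ an orientation, $F$ a set of arcs of $D$): if $F$ does not contain all arcs of $D$, let $a=(u,v)$ be the arc of $D$ corresponding to the smallest edge not in $F$; call EnOPODS$(D,F\cup\{a\})$; then, if the digraph $D$ with the arcs of $F$ removed contains a directed path $P$ from $v$ to $u$, call EnOPODS$(D^{P\cup\{a\}},F\cup\{a^-\})$. Otherwise (all arcs fixed) output $D$. Algorithm 2: if an $\alpha$-orientation $D$ of $G$ exists (found by a flow computation in $O(mn)$ time), fix a linear order on the edges and call EnOPODS$(D,\emptyset)$. Delay: the maximum time between two consecutive outputs, including before the first and after the last output.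
   Formalization: The delay bound O(m²) is proved for m > 0 and no isolated vertices; for all loopless multigraphs the bound is O(m²+n+1), since α must be read at isolated vertices, so O(m²) fails for m=1 with many isolated vertices. *)

theory Defs
  imports "HOL-Library.Monad_Syntax"
begin

section \<open>Multigraphs and orientations\<close>

text \<open>
  The vertex set is \<open>{0..<num_verts G}\<close>. The edges are named by their positions in the list
  \<open>ends G\<close> of (unordered, although stored as ordered) pairs of endpoints, so parallel edges are
  different edges. The order of the list is the fixed linear order on the edges.
\<close>

record multigraph =
  num_verts :: nat
  ends :: "(nat \<times> nat) list"

definition num_edges :: "multigraph \<Rightarrow> nat" where
  "num_edges G = length (ends G)"

definition loopless_multigraph :: "multigraph \<Rightarrow> bool" where
  "loopless_multigraph G \<longleftrightarrow>
     (\<forall>(u, v) \<in> set (ends G). u < num_verts G \<and> v < num_verts G \<and> u \<noteq> v)"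

text \<open>
  An algorithm must at least read \<open>\<alpha>\<close> at every isolated vertex, so a time bound in terms of the
  number of edges alone needs the absence of isolated vertices (or a term for the vertices).
\<close>

definition no_isolated_vertex :: "multigraph \<Rightarrow> bool" where
  "no_isolated_vertex G \<longleftrightarrow>
     (\<forall>w < num_verts G. \<exists>(u, v) \<in> set (ends G). w = u \<or> w = v)"

text \<open>
  An orientation lists, for every edge, the chosen (tail, head) pair. An arc of an orientation
  \<open>D\<close> is \<open>(i, D ! i)\<close>; carrying the edge \<open>i\<close> keeps parallel arcs apart.
\<close>

type_synonym orientation = "(nat \<times> nat) list"
type_synonym arc = "nat \<times> nat \<times> nat"

definition is_orientation :: "multigraph \<Rightarrow> orientation \<Rightarrow> bool" where
  "is_orientation G D \<longleftrightarrow> length D = num_edges G \<and>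
     (\<forall>i < num_edges G. D ! i = ends G ! i \<or> D ! i = prod.swap (ends G ! i))"

definition outdegree :: "orientation \<Rightarrow> nat \<Rightarrow> nat" where
  "outdegree D v = card {i. i < length D \<and> fst (D ! i) = v}"

definition alpha_orientation :: "multigraph \<Rightarrow> (nat \<Rightarrow> nat) \<Rightarrow> orientation \<Rightarrow> bool" where
  "alpha_orientation G \<alpha> D \<longleftrightarrow>
     is_orientation G D \<and> (\<forall>v < num_verts G. outdegree D v = \<alpha> v)"

text \<open>The orientation \<open>D\<close> with the arcs of the edges in \<open>B\<close> reversed.\<close>

definition reverse_arcs :: "nat list \<Rightarrow> orientation \<Rightarrow> orientation" where
  "reverse_arcs B D = map (\<lambda>i. if i \<in> set B then prod.swap (D ! i) else D ! i) [0..<length D]"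

lemma length_reverse_arcs [simp]: "length (reverse_arcs B D) = length D"
  by (simp add: reverse_arcs_def)


section \<open>Computations with running time and output\<close>

text \<open>
  A computation yields a result together with the chronological trace of its unit-cost steps and
  of its outputs. The cost model is a random access machine: functions on vertices or edges
  (counters, adjacency lists, markings) and orientations are arrays; sets of arcs and of vertices
  are Boolean arrays. Reading or writing one cell, comparing two numbers, and putting one element
  in front of a linked list are charged a constant number of steps. Copying an orientation or a
  set of arcs is charged a step per edge.
\<close>

datatype event = Step | Output orientation

type_synonym 'a comp = "'a \<times> event list"

definition return :: "'a \<Rightarrow> 'a comp" where
  "return x = (x, [])"

definition steps :: "nat \<Rightarrow> unit comp" where
  "steps k = ((), replicate k Step)"

definition emit :: "orientation \<Rightarrow> unit comp" where
  "emit D = ((), [Output D])"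

definition bind_comp :: "'a comp \<Rightarrow> ('a \<Rightarrow> 'b comp) \<Rightarrow> 'b comp" where
  "bind_comp c f = (fst (f (fst c)), snd c @ snd (f (fst c)))"

adhoc_overloading Monad_Syntax.bind \<rightleftharpoons> bind_comp

lemma bind_comp_cong [fundef_cong]:
  assumes "c = c'" and "\<And>x. x = fst c' \<Longrightarrow> f x = f' x"
  shows "bind_comp c f = bind_comp c' f'"
  using assms by (simp add: bind_comp_def)

fun outputs :: "event list \<Rightarrow> orientation list" where
  "outputs [] = []"
| "outputs (Step # es) = outputs es"
| "outputs (Output D # es) = D # outputs es"

text \<open>
  The numbers of steps before the first output, between consecutive outputs, and after the last
  output; the total number of steps if there is no output.
\<close>

fun gaps :: "event list \<Rightarrow> nat list" where
  "gaps [] = [0]"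
| "gaps (Step # es) = Suc (hd (gaps es)) # tl (gaps es)"
| "gaps (Output D # es) = 0 # gaps es"

definition delay :: "event list \<Rightarrow> nat" where
  "delay es = Max (set (gaps es))"


section \<open>Directed path search\<close>

fun find_first :: "('a \<Rightarrow> bool) \<Rightarrow> 'a list \<Rightarrow> 'a option comp" where
  "find_first P [] = do { steps 1; return None }"
| "find_first P (x # xs) = do { steps 1; if P x then return (Some x) else find_first P xs }"

lemma find_first_Some:
  "fst (find_first P xs) = Some x \<Longrightarrow> x \<in> set xs \<and> P x"
  by (induction xs) (auto simp: bind_comp_def return_def split: if_splits)

text \<open>The lists of outgoing arcs (given by their edges) of \<open>D\<close> with the arcs of \<open>F\<close> removed.\<close>

fun adjacency ::
  "orientation \<Rightarrow> arc set \<Rightarrow> nat list \<Rightarrow> (nat \<Rightarrow> nat list) \<Rightarrow> (nat \<Rightarrow> nat list) comp" where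
  "adjacency D F [] adj = return adj"
| "adjacency D F (i # is) adj = do {
     steps 1;
     adjacency D F is
       (if (i, D ! i) \<in> F then adj else adj(fst (D ! i) := i # adj (fst (D ! i))))
   }"

text \<open>
  Depth-first search. The first list is the worklist of arcs leaving visited vertices;
  \<open>route w\<close> is \<open>None\<close> if \<open>w\<close> has not been visited, and otherwise \<open>Some P\<close> with \<open>P\<close> the edges of
  a directed path from the start vertex to \<open>w\<close>, last edge first (these lists share their tails).
  The test \<open>i < length D\<close> is always true in the use below; it makes the recursion terminate on
  arbitrary arguments.
\<close>

function explore ::
  "orientation \<Rightarrow> (nat \<Rightarrow> nat list) \<Rightarrow> nat list \<Rightarrow> (nat \<Rightarrow> nat list option) \<Rightarrow>
   (nat \<Rightarrow> nat list option) comp" where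
  "explore D adj [] route = do { steps 1; return route }"
| "explore D adj (i # is) route =
     (let u = fst (D ! i); v = snd (D ! i) in
      if i < length D \<and> route v = None
      then do {
        steps (length (adj v) + 1);
        explore D adj (adj v @ is) (route(v := Some (i # the (route u))))
      }
      else do { steps 1; explore D adj is route })"
  by pat_completeness auto
termination
proof (relation "measures
    [\<lambda>(D, adj, is, route). card {w \<in> snd ` set D. route w = None},
     \<lambda>(D, adj, is, route). length is]", goal_cases)
  case 1
  show ?case by simp
next
  case (2 D adj i "is" route u v x)
  have new: "v \<in> snd ` set D" "route v = None"
    unfolding 2(2) using 2(3) by (simp_all add: 2(2))
  have "{w \<in> snd ` set D. (route(v := Some (i # the (route u)))) w = None}
        \<subset> {w \<in> snd ` set D. route w = None}"
    using new by (auto split: if_splits)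
  then have "card {w \<in> snd ` set D. (route(v := Some (i # the (route u)))) w = None}
        < card {w \<in> snd ` set D. route w = None}"
    by (intro psubset_card_mono) auto
  then show ?case by simp
next
  case (3 D adj i "is" route u v x)
  show ?case by simp
qed

text \<open>
  The first charge is for resetting \<open>adj\<close> and \<open>route\<close> at \<open>s\<close> and at both endpoints of every edge;
  other cells are not accessed.
\<close>

definition search :: "orientation \<Rightarrow> arc set \<Rightarrow> nat \<Rightarrow> (nat \<Rightarrow> nat list option) comp" where
  "search D F s = do {
     steps (4 * length D + 2);
     adj \<leftarrow> adjacency D F [0..<length D] (\<lambda>_. []);
     steps (length (adj s));
     explore D adj (adj s) ((\<lambda>_. None)(s := Some []))
   }"


section \<open>The enumeration procedure\<close>

text \<open>
  \<open>F\<close> always consists of arcs of \<open>D\<close>. The charges are for copying \<open>D\<close> and \<open>F\<close> when a call is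
  made, for computing the reversed orientation, for writing an output, and for returning from a
  call (after which the caller still has to be resumed).
\<close>

function enopods :: "orientation \<Rightarrow> arc set \<Rightarrow> unit comp" where
  "enopods D F = do {
     next_edge \<leftarrow> find_first (\<lambda>i. i \<notin> fst ` F) [0..<length D];
     case next_edge of
       None \<Rightarrow> do { steps (length D); emit D }
     | Some i \<Rightarrow>
         let u = fst (D ! i); v = snd (D ! i) in
         do {
           steps (2 * length D + 1);
           enopods D (insert (i, u, v) F);
           steps 1;
           route \<leftarrow> search D F v;
           case route u of
             None \<Rightarrow> return ()
           | Some P \<Rightarrow> do {
               steps (3 * length D + length P + 1);
               enopods (reverse_arcs (i # P) D) (insert (i, v, u) F);
               steps 1
             }
         }
   }"
  by pat_completeness auto
termination
proof -
  have less: "card {j. j < length D \<and> j \<notin> fst ` insert (i, p) F}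
      < card {j. j < length D \<and> j \<notin> fst ` F}"
    if "Some i = fst (find_first (\<lambda>i. i \<notin> fst ` F) [0..<length D])" for i p and D :: orientation and F :: "arc set"
    using find_first_Some[OF that[symmetric]] by (intro psubset_card_mono) auto
  show ?thesis
  proof (relation "measure (\<lambda>(D, F). card {j. j < length D \<and> j \<notin> fst ` F})", goal_cases)
    case 1
    show ?case by (rule wf_measure)
  next
    case 2
    show ?case
      unfolding in_measure prod.case by (rule less) (rule trans[OF 2(2)[symmetric] 2(1)])
  next
    case 3
    show ?case
      unfolding in_measure prod.case length_reverse_arcs
      by (rule less) (rule trans[OF 3(2)[symmetric] 3(1)])
  qed
qed

declare enopods.simps [simp del]


section \<open>The enumeration algorithm\<close>

fun count_out :: "orientation \<Rightarrow> (nat \<Rightarrow> nat) \<Rightarrow> (nat \<Rightarrow> nat) comp" where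
  "count_out [] d = return d"
| "count_out (a # as) d = do { steps 1; count_out as (d(fst a := Suc (d (fst a)))) }"

text \<open>
  Flow computation by augmenting paths: an arc carries one unit from its tail to its head by being
  reversed, vertices with too large outdegree are sources, those with too small outdegree are
  sinks. The numeric argument bounds the number of rounds. Each augmentation lowers the total
  excess, which is at most the number of edges \<open>m\<close>, so that \<open>O(m)\<close> searches of \<open>O(m)\<close> steps are made.
\<close>

fun augment :: "nat \<Rightarrow> (nat \<Rightarrow> nat) \<Rightarrow> orientation \<Rightarrow> orientation option comp" where
  "augment 0 \<alpha> D = return None"
| "augment (Suc k) \<alpha> D = do {
     steps (2 * length D);
     d \<leftarrow> count_out D (\<lambda>_. 0);
     let vs = map fst D @ map snd D;
     source \<leftarrow> find_first (\<lambda>v. \<alpha> v < d v) vs;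
     case source of
       None \<Rightarrow> do {
         deficient \<leftarrow> find_first (\<lambda>v. d v < \<alpha> v) vs;
         return (if deficient = None then Some D else None)
       }
     | Some s \<Rightarrow> do {
         route \<leftarrow> search D {} s;
         sink \<leftarrow> find_first (\<lambda>t. d t < \<alpha> t \<and> route t \<noteq> None) vs;
         case sink of
           None \<Rightarrow> return None
         | Some t \<Rightarrow> do {
             steps (2 * length D + length (the (route t)));
             augment k \<alpha> (reverse_arcs (the (route t)) D)
           }
       }
   }"

text \<open>
  Isolated vertices are dealt with separately, in a single pass over all vertices, after having
  marked the endpoints of the edges.
\<close>

definition find_alpha_orientation ::
  "multigraph \<Rightarrow> (nat \<Rightarrow> nat) \<Rightarrow> orientation option comp" where
  "find_alpha_orientation G \<alpha> = do {
     steps (num_verts G + 2 * num_edges G);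
     bad \<leftarrow> find_first (\<lambda>v. v \<notin> fst ` set (ends G) \<union> snd ` set (ends G) \<and> \<alpha> v \<noteq> 0)
              [0..<num_verts G];
     case bad of
       Some v \<Rightarrow> return None
     | None \<Rightarrow> do {
         steps (num_edges G);
         augment (Suc (num_edges G)) \<alpha> (ends G)
       }
   }"

definition enumerate_alpha_orientations :: "multigraph \<Rightarrow> (nat \<Rightarrow> nat) \<Rightarrow> unit comp" where
  "enumerate_alpha_orientations G \<alpha> = do {
     start \<leftarrow> find_alpha_orientation G \<alpha>;
     case start of
       None \<Rightarrow> return ()
     | Some D \<Rightarrow> do { steps 1; enopods D {} }
   }"

end

theory Submission
  imports Defs
begin

text \<open>
  A call of the procedure on \<open>(D, F)\<close> outputs the orientations with the outdegrees of \<open>D\<close> that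
  contain \<open>F\<close>. The two recursive calls split these by the direction of the chosen edge \<open>(u, v)\<close>:
  reversing a directed cycle through \<open>(u, v)\<close> preserves all outdegrees, and if \<open>u\<close> is not reachable
  from \<open>v\<close> avoiding \<open>F\<close>, then counting the tails among the vertices reachable from \<open>v\<close> shows that no
  orientation with the same outdegrees contains \<open>(v, u)\<close>. So no call is in vain, and between two
  outputs \<open>O(m)\<close> calls of cost \<open>O(m)\<close> are entered or left. The initial orientation results from path
  reversals that each decrease the total excess of outdegrees; the same counting of tails shows
  that there is no solution when no deficient vertex can be reached from a vertex with excess.
\<close>

section \<open>Step counts between outputs and their behaviour under concatenation\<close>

section \<open>Traces\<close>

lemma fst_bind_comp [simp]: "fst (bind_comp c f) = fst (f (fst c))"
  and snd_bind_comp [simp]: "snd (bind_comp c f) = snd c @ snd (f (fst c))"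
  by (simp_all add: bind_comp_def)

lemma fst_return [simp]: "fst (return x) = x"
  and snd_return [simp]: "snd (return x) = []"
  by (simp_all add: return_def)

lemma snd_steps [simp]: "snd (steps k) = replicate k Step"
  by (simp add: steps_def)

lemma snd_emit [simp]: "snd (emit D) = [Output D]"
  by (simp add: emit_def)

lemma outputs_append [simp]: "outputs (xs @ ys) = outputs xs @ outputs ys"
  by (induction xs rule: outputs.induct) auto

lemma outputs_replicate_Step [simp]: "outputs (replicate k Step) = []"
  by (induction k) auto

lemma gaps_neq_Nil [simp]: "gaps es \<noteq> []"
  by (induction es rule: gaps.induct) auto

text \<open>The steps before the first output of \<open>ys\<close> continue the stretch after the
  last output of \<open>xs\<close>, so exactly these two gaps merge.\<close>

lemma gaps_append:
  "gaps (xs @ ys) = butlast (gaps xs) @ (last (gaps xs) + hd (gaps ys)) # tl (gaps ys)"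
proof (induction xs rule: gaps.induct)
  case (2 es)
  show ?case
  \<comment> \<open>A leading step increments the first gap. If there is only one gap, it is also
    the last one, which takes part in the merge.\<close>
  proof (cases "butlast (gaps es)")
    case Nil
    then have "gaps es = [last (gaps es)]"
      by (metis append_Nil append_butlast_last_id gaps_neq_Nil)
    then obtain g where "gaps es = [g]" ..
    with 2 show ?thesis by simp
  next
    case (Cons g gs)
    then have "gaps es = g # gs @ [last (gaps es)]"
      by (metis append_Cons append_butlast_last_id gaps_neq_Nil)
    then obtain l where "gaps es = g # gs @ [l]" ..
    with 2 show ?thesis by (simp add: butlast_append)
  qed
qed auto

lemma gaps_silent: "outputs es = [] \<Longrightarrow> gaps es = [length es]"
  by (induction es rule: outputs.induct) auto

text \<open>An output separates the first gap from the last, so a change at one end of the trace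
  leaves the other end alone.\<close>

lemma gaps_first_last:
  assumes "outputs es \<noteq> []"
  obtains g gs l where "gaps es = g # gs @ [l]"
proof -
  have "tl (gaps es) \<noteq> []"
    using assms by (induction es rule: outputs.induct) auto
  then show thesis
    using that by (metis append_butlast_last_id gaps_neq_Nil list.collapse)
qed

text \<open>Separate bounds for the two outer gaps make the notion compositional. An output is
  demanded because in a silent trace the first gap is also the last.\<close>

definition gap_bounded :: "nat \<Rightarrow> nat \<Rightarrow> nat \<Rightarrow> event list \<Rightarrow> bool" where
  "gap_bounded a b c es \<longleftrightarrow>
     outputs es \<noteq> [] \<and> hd (gaps es) \<le> a \<and> last (gaps es) \<le> b \<and> (\<forall>g \<in> set (gaps es). g \<le> c)"

lemma gap_bounded_delay: "gap_bounded a b c es \<Longrightarrow> delay es \<le> c"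
  unfolding gap_bounded_def delay_def by simp

lemma delay_silent: "outputs es = [] \<Longrightarrow> delay es = length es"
  unfolding delay_def by (simp add: gaps_silent)

lemma gap_bounded_Output: "gap_bounded 0 0 0 [Output D]"
  by (simp add: gap_bounded_def)

lemma gap_bounded_mono:
  "gap_bounded a b c es \<Longrightarrow> a \<le> a' \<Longrightarrow> b \<le> b' \<Longrightarrow> c \<le> c' \<Longrightarrow> gap_bounded a' b' c' es"
  unfolding gap_bounded_def by (meson order_trans)

text \<open>The only gap not inherited from either part is the one across the junction, at most
  \<open>b + a'\<close>.\<close>

lemma gap_bounded_append:
  assumes "gap_bounded a b c xs" and "gap_bounded a' b' c' ys"
    and "c \<le> d" and "c' \<le> d" and "b + a' \<le> d"
  shows "gap_bounded a b' d (xs @ ys)"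
proof -
  obtain g gs l where xs: "gaps xs = g # gs @ [l]"
    using gaps_first_last[of xs] assms(1) unfolding gap_bounded_def by blast
  obtain h hs k where ys: "gaps ys = h # hs @ [k]"
    using gaps_first_last[of ys] assms(2) unfolding gap_bounded_def by blast
  have "gaps (xs @ ys) = g # gs @ (l + h) # hs @ [k]"
    by (simp add: gaps_append xs ys butlast_append)
  then show ?thesis
    using assms unfolding gap_bounded_def xs ys by auto
qed

lemma gap_bounded_prepend:
  assumes "outputs xs = []" and "gap_bounded a b c ys"
    and "length xs + a \<le> a'" and "a' \<le> d" and "c \<le> d"
  shows "gap_bounded a' b d (xs @ ys)"
proof -
  obtain h hs k where ys: "gaps ys = h # hs @ [k]"
    using gaps_first_last[of ys] assms(2) unfolding gap_bounded_def by blast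
  have "gaps (xs @ ys) = (length xs + h) # hs @ [k]"
    by (simp add: gaps_append gaps_silent[OF assms(1)] ys)
  then show ?thesis
    using assms unfolding gap_bounded_def ys by auto
qed

lemma gap_bounded_postpend:
  assumes "outputs ys = []" and "gap_bounded a b c xs"
    and "length ys + b \<le> b'" and "b' \<le> d" and "c \<le> d"
  shows "gap_bounded a b' d (xs @ ys)"
proof -
  obtain g gs l where xs: "gaps xs = g # gs @ [l]"
    using gaps_first_last[of xs] assms(2) unfolding gap_bounded_def by blast
  have "gaps (xs @ ys) = g # gs @ [l + length ys]"
    by (simp add: gaps_append gaps_silent[OF assms(1)] xs butlast_append)
  then show ?thesis
    using assms unfolding gap_bounded_def xs by auto
qed

section \<open>Reorientations as an equivalence relation, and counting of tails\<close>

section \<open>Reorientations\<close>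

text \<open>Relating orientations directly to each other dispenses with the multigraph: any member
  represents the class, \<open>ends G\<close> being one of them.\<close>

definition reorientation :: "orientation \<Rightarrow> orientation \<Rightarrow> bool" where
  "reorientation D D' \<longleftrightarrow> length D' = length D \<and>
     (\<forall>i < length D. D' ! i = D ! i \<or> D' ! i = prod.swap (D ! i))"

lemma reorientation_refl: "reorientation D D"
  by (simp add: reorientation_def)

lemma reorientation_sym: "reorientation D D' \<Longrightarrow> reorientation D' D"
  unfolding reorientation_def by (metis swap_swap)

lemma reorientation_trans:
  "reorientation D D' \<Longrightarrow> reorientation D' D'' \<Longrightarrow> reorientation D D''"
  unfolding reorientation_def by (metis swap_swap)

lemma reorientation_eq:
  assumes "reorientation D D'"
  shows "reorientation D' = reorientation D"
proof (intro ext iffI)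
  show "reorientation D E" if "reorientation D' E" for E
    using reorientation_trans[OF assms that] .
  show "reorientation D' E" if "reorientation D E" for E
    using reorientation_trans[OF reorientation_sym[OF assms] that] .
qed

lemma is_orientation_iff: "is_orientation G D \<longleftrightarrow> reorientation (ends G) D"
  by (simp add: is_orientation_def reorientation_def num_edges_def)

lemma reorientation_reverse_arcs: "reorientation D (reverse_arcs B D)"
  by (simp add: reorientation_def reverse_arcs_def)

lemma nth_reverse_arcs:
  "i < length D \<Longrightarrow> reverse_arcs B D ! i = (if i \<in> set B then prod.swap (D ! i) else D ! i)"
  by (simp add: reverse_arcs_def)

lemma sum_outdegree:
  assumes "finite R"
  shows "(\<Sum>v\<in>R. outdegree D v) = card {i. i < length D \<and> fst (D ! i) \<in> R}"
proof -
  have "{i. i < length D \<and> fst (D ! i) \<in> R} = (\<Union>v\<in>R. {i. i < length D \<and> fst (D ! i) = v})"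
    by auto
  moreover have "card \<dots> = (\<Sum>v\<in>R. outdegree D v)"
    unfolding outdegree_def using assms by (intro card_UN_disjoint) auto
  ultimately show ?thesis by simp
qed

text \<open>An edge with its tail in \<open>R\<close> either keeps its direction or has both ends in
  \<open>R\<close>, so its tail in \<open>D'\<close> is still in \<open>R\<close>. This is the cut
  argument behind both proofs of nonexistence.\<close>

lemma tails_in_closed_set:
  assumes "reorientation D D'"
    and "\<And>j. j < length D \<Longrightarrow> fst (D ! j) \<in> R \<Longrightarrow> D' ! j = D ! j \<or> snd (D ! j) \<in> R"
  shows "{j. j < length D \<and> fst (D ! j) \<in> R} \<subseteq> {j. j < length D' \<and> fst (D' ! j) \<in> R}"
proof
  fix j assume "j \<in> {j. j < length D \<and> fst (D ! j) \<in> R}"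
  then have j: "j < length D" "fst (D ! j) \<in> R" by simp_all
  then have "j < length D'" and "D' ! j = D ! j \<or> D' ! j = prod.swap (D ! j)"
    using assms(1) by (auto simp: reorientation_def)
  then show "j \<in> {j. j < length D' \<and> fst (D' ! j) \<in> R}"
    using assms(2)[OF j] j by auto
qed

text \<open>Edges outside \<open>P\<close> contribute equally to both outdegrees; on
  \<open>P\<close>, heads replace tails. The additive form avoids truncated subtraction.\<close>

lemma outdegree_reverse_arcs:
  assumes "distinct P" and "set P \<subseteq> {..<length D}"
  shows "outdegree (reverse_arcs P D) x + length (filter (\<lambda>j. fst (D ! j) = x) P)
       = outdegree D x + length (filter (\<lambda>j. snd (D ! j) = x) P)"
proof -
  let ?keep = "{j. j < length D \<and> j \<notin> set P \<and> fst (D ! j) = x}"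
  let ?tails = "{j. fst (D ! j) = x} \<inter> set P" and ?heads = "{j. snd (D ! j) = x} \<inter> set P"
  have "{j. j < length D \<and> fst (D ! j) = x} = ?keep \<union> ?tails"
    using assms(2) by auto
  moreover have "card (?keep \<union> ?tails) = card ?keep + card ?tails"
    by (rule card_Un_disjoint) auto
  moreover have "{j. j < length D \<and> fst (reverse_arcs P D ! j) = x} = ?keep \<union> ?heads"
    using assms(2) by (auto simp: nth_reverse_arcs split: if_splits)
  moreover have "card (?keep \<union> ?heads) = card ?keep + card ?heads"
    by (rule card_Un_disjoint) auto
  ultimately show ?thesis
    by (simp add: outdegree_def distinct_length_filter[OF assms(1)])
qed

section \<open>Correctness and linear running time of the depth-first search\<close>

section \<open>Directed path search\<close>

lemma find_first_None: "fst (find_first P xs) = None \<Longrightarrow> x \<in> set xs \<Longrightarrow> \<not> P x"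
  by (induction xs) (auto split: if_splits)

lemma outputs_find_first [simp]: "outputs (snd (find_first P xs)) = []"
  by (induction xs) auto

lemma time_find_first: "length (snd (find_first P xs)) \<le> Suc (length xs)"
  by (induction xs) auto

lemma set_adjacency:
  "set (fst (adjacency D F is adj) w) =
     {j \<in> set is. (j, D ! j) \<notin> F \<and> fst (D ! j) = w} \<union> set (adj w)"
  by (induction "is" arbitrary: adj) auto

lemma outputs_adjacency [simp]: "outputs (snd (adjacency D F is adj)) = []"
  and time_adjacency: "length (snd (adjacency D F is adj)) = length is"
  by (induction "is" arbitrary: adj) auto

text \<open>Each edge enters at most one list, that of its tail. This is what keeps the search
  linear.\<close>

lemma sum_length_adjacency:
  assumes "finite W"
  shows "(\<Sum>w\<in>W. length (fst (adjacency D F is adj) w)) \<le> length is + (\<Sum>w\<in>W. length (adj w))"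
proof (induction "is" arbitrary: adj)
  case (Cons i "is")
  have "(\<Sum>w\<in>W. length ((adj(u := i # adj u)) w)) \<le> Suc (\<Sum>w\<in>W. length (adj w))" for u
  proof -
    have "(\<Sum>w\<in>W. length ((adj(u := i # adj u)) w))
        = (\<Sum>w\<in>W. length (adj w) + (if w = u then 1 else 0))"
      by (rule sum.cong) auto
    also have "\<dots> \<le> Suc (\<Sum>w\<in>W. length (adj w))"
      using assms by (simp add: sum.distrib)
    finally show ?thesis .
  qed
  from order_trans[OF Cons add_left_mono[OF this]] Cons[of adj]
  show ?case by (simp del: fun_upd_apply)
qed simp

text \<open>As in routes, the last edge of the path comes first.\<close>

fun dipath :: "orientation \<Rightarrow> nat \<Rightarrow> nat list \<Rightarrow> nat \<Rightarrow> bool" where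
  "dipath D s [] w \<longleftrightarrow> w = s"
| "dipath D s (i # P) w \<longleftrightarrow> snd (D ! i) = w \<and> dipath D s P (fst (D ! i))"

text \<open>A walk enters each vertex as often as it leaves it, except at its ends. For
  \<open>s = t\<close> the corrections cancel.\<close>

lemma dipath_degree_balance:
  "dipath D s P t \<Longrightarrow>
     length (filter (\<lambda>j. fst (D ! j) = x) P) + of_bool (x = t)
   = length (filter (\<lambda>j. snd (D ! j) = x) P) + of_bool (x = s)"
proof (induction P arbitrary: t)
  case (Cons i P)
  then have "dipath D s P (fst (D ! i))" and "snd (D ! i) = t" by simp_all
  from Cons.IH[OF this(1)] this(2) show ?case by auto
qed auto

text \<open>Invariant of the search along the arcs in \<open>A\<close>. That all heads on a route
  are visited keeps routes distinct when they are extended; that no head is \<open>s\<close> later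
  keeps the arc \<open>(u, v)\<close> off a route from \<open>v\<close>.\<close>

definition routing ::
  "orientation \<Rightarrow> nat set \<Rightarrow> nat \<Rightarrow> (nat \<Rightarrow> nat list option) \<Rightarrow> bool" where
  "routing D A s route \<longleftrightarrow> route s = Some [] \<and>
     (\<forall>w P. route w = Some P \<longrightarrow> dipath D s P w \<and> set P \<subseteq> A \<and> distinct P \<and>
        (\<forall>j \<in> set P. snd (D ! j) \<noteq> s \<and> route (snd (D ! j)) \<noteq> None))"

lemma routing_extend:
  assumes "routing D A s route" and "route (fst (D ! i)) = Some P"
    and "route (snd (D ! i)) = None" and "i \<in> A"
  shows "routing D A s (route(snd (D ! i) := Some (i # P)))"
proof -
  let ?route = "route(snd (D ! i) := Some (i # P))"
  have P: "dipath D s P (fst (D ! i))" "set P \<subseteq> A" "distinct P"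
    and heads: "\<forall>j \<in> set P. snd (D ! j) \<noteq> s \<and> route (snd (D ! j)) \<noteq> None"
    using assms(1,2) unfolding routing_def by simp_all
  have s: "route s = Some []" using assms(1) by (simp add: routing_def)
  then have "snd (D ! i) \<noteq> s" using assms(3) by auto
  \<comment> \<open>Heads on \<open>P\<close> are visited, the head of \<open>i\<close> is
    not.\<close>
  moreover have "i \<notin> set P" using heads assms(3) by auto
  ultimately have "dipath D s (i # P) (snd (D ! i)) \<and> set (i # P) \<subseteq> A \<and> distinct (i # P) \<and>
      (\<forall>j \<in> set (i # P). snd (D ! j) \<noteq> s \<and> ?route (snd (D ! j)) \<noteq> None)"
    using P heads assms(4) by auto
  moreover have "dipath D s Q w \<and> set Q \<subseteq> A \<and> distinct Q \<and>
      (\<forall>j \<in> set Q. snd (D ! j) \<noteq> s \<and> ?route (snd (D ! j)) \<noteq> None)"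
    if "route w = Some Q" for w Q
    using assms(1) that unfolding routing_def by simp
  ultimately show ?thesis
    unfolding routing_def using s \<open>snd (D ! i) \<noteq> s\<close> by (simp del: dipath.simps)
qed

text \<open>The last two assumptions are the worklist invariant: it holds only usable arcs leaving
  visited vertices, and every such arc to an unvisited head. Once it is empty, the visited set is
  closed under \<open>A\<close>.\<close>

lemma routing_explore:
  assumes "routing D A s route" and "A \<subseteq> {..<length D}"
    and "\<And>w. set (adj w) = {j \<in> A. fst (D ! j) = w}"
    and "\<And>j. j \<in> set is \<Longrightarrow> j \<in> A \<and> route (fst (D ! j)) \<noteq> None"
    and "\<And>j. j \<in> A \<Longrightarrow> route (fst (D ! j)) \<noteq> None \<Longrightarrow> j \<in> set is \<or> route (snd (D ! j)) \<noteq> None"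
  defines "route' \<equiv> fst (explore D adj is route)"
  shows "routing D A s route' \<and>
     (\<forall>j \<in> A. route' (fst (D ! j)) \<noteq> None \<longrightarrow> route' (snd (D ! j)) \<noteq> None)"
  using assms(1-5) unfolding route'_def
proof (induction D adj "is" route rule: explore.induct)
  case (1 D adj route)
  have "route (snd (D ! j)) \<noteq> None" if "j \<in> A" "route (fst (D ! j)) \<noteq> None" for j
    using "1.prems"(5)[OF that] by simp
  then show ?case using "1.prems"(1) by simp
next
  case (2 D adj i "is" route)
  let ?u = "fst (D ! i)" and ?v = "snd (D ! i)"
  have i: "i \<in> A" "i < length D" "route ?u \<noteq> None"
    using "2.prems"(2,4) by auto
  show ?case
  proof (cases "route ?v = None")
    case True
    obtain P where P: "route ?u = Some P" using i by blast
    let ?route = "route(?v := Some (i # P))"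
    have "routing D A s ?route"
      using routing_extend[OF "2.prems"(1) P True i(1)] .
    moreover have "j \<in> A \<and> ?route (fst (D ! j)) \<noteq> None" if "j \<in> set (adj ?v @ is)" for j
      using that "2.prems"(3,4) by auto
    moreover have "j \<in> set (adj ?v @ is) \<or> ?route (snd (D ! j)) \<noteq> None"
      if "j \<in> A" "?route (fst (D ! j)) \<noteq> None" for j
      using that "2.prems"(3) "2.prems"(5)[of j] by (auto split: if_splits)
    moreover have "fst (explore D adj (i # is) route)
        = fst (explore D adj (adj ?v @ is) ?route)"
      using True i(2) P by (simp add: Let_def)
    ultimately show ?thesis
      using "2.IH"(1)[OF refl refl conjI[OF i(2) True] refl] "2.prems"(2,3)
      unfolding P option.sel by presburger
  next
    case False
    have "j \<in> set is \<or> route (snd (D ! j)) \<noteq> None"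
      if "j \<in> A" "route (fst (D ! j)) \<noteq> None" for j
      using "2.prems"(5)[OF that] False by auto
    moreover have "j \<in> A \<and> route (fst (D ! j)) \<noteq> None" if "j \<in> set is" for j
      using that "2.prems"(4) by simp
    moreover have "fst (explore D adj (i # is) route) = fst (explore D adj is route)"
      using False by (auto simp: Let_def)
    moreover have "\<not> (i < length D \<and> route ?v = None)" using False by simp
    ultimately show ?thesis
      using "2.IH"(2)[OF refl refl _ refl] "2.prems"(1-3) by presburger
  qed
qed

lemma outputs_explore [simp]: "outputs (snd (explore D adj is route)) = []"
proof (induction D adj "is" route rule: explore.induct)
  case (2 D adj i "is" route)
  then show ?case by (simp add: Let_def del: fun_upd_apply)
qed auto

text \<open>
  An adjacency list is put on the worklist only when its vertex is visited for the first time;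
  each of its entries is charged once then and once when it is taken from the worklist.
\<close>

lemma time_explore:
  "length (snd (explore D adj is route))
     \<le> Suc (length is + 2 * (\<Sum>w | w \<in> snd ` set D \<and> route w = None. length (adj w)))"
proof (induction D adj "is" route rule: explore.induct)
  case (2 D adj i "is" route)
  let ?v = "snd (D ! i)"
  show ?case
  proof (cases "i < length D \<and> route ?v = None")
    case True
    let ?W = "{w. w \<in> snd ` set D \<and> route w = None}"
    let ?W' = "{w. w \<in> snd ` set D \<and> (route(?v := Some (i # the (route (fst (D ! i)))))) w = None}"
    have v: "?v \<in> ?W" using True by auto
    \<comment> \<open>Visiting \<open>?v\<close> removes its list from the sum. The factor 2 pays
      for the charge on that list and for the growth of the worklist; taking \<open>i\<close> off
      pays for the remaining step.\<close>
    have "?W' = ?W - {?v}" by auto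
    then have "(\<Sum>w\<in>?W. length (adj w)) = length (adj ?v) + (\<Sum>w\<in>?W'. length (adj w))"
      using sum.remove[OF _ v] by simp
    then show ?thesis
      using "2.IH"(1)[OF refl refl True] True by (simp add: Let_def del: fun_upd_apply)
  next
    case False
    then show ?thesis using "2.IH"(2)[OF refl refl False] by (auto simp: Let_def)
  qed
qed auto

lemma outputs_search [simp]: "outputs (snd (search D F s)) = []"
  by (simp add: search_def)

lemma time_search: "length (snd (search D F s)) \<le> 9 * length D + 4"
proof -
  let ?adj = "fst (adjacency D F [0..<length D] (\<lambda>_. []))"
  have sum: "(\<Sum>w\<in>W. length (?adj w)) \<le> length D" if "finite W" for W
    using sum_length_adjacency[OF that, of D F "[0..<length D]" "\<lambda>_. []"] by simp
  have visit: "(\<Sum>w | w \<in> snd ` set D \<and> ((\<lambda>_. None)(s := Some [])) w = None. length (?adj w)) \<le> length D"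
    by (rule sum) simp
  \<comment> \<open>With \<open>m = length D\<close>, resetting costs \<open>4 * m + 2\<close>,
    building the lists \<open>m\<close>, the list of \<open>s\<close> at most \<open>m\<close>, and
    the exploration at most \<open>3 * m + 1\<close>.\<close>
  have "length (snd (explore D ?adj (?adj s) ((\<lambda>_. None)(s := Some []))))
      \<le> Suc (length (?adj s) + 2 * length D)"
    by (rule order_trans[OF time_explore]) (use visit in simp)
  moreover have "length (?adj s) \<le> length D"
    using sum[of "{s}"] by simp
  ultimately show ?thesis
    by (simp add: search_def time_adjacency)
qed

lemma search_routing:
  fixes D F s
  defines "A \<equiv> {j. j < length D \<and> (j, D ! j) \<notin> F}"
  defines "route \<equiv> fst (search D F s)"
  shows "routing D A s route"
    and "j \<in> A \<Longrightarrow> route (fst (D ! j)) \<noteq> None \<Longrightarrow> route (snd (D ! j)) \<noteq> None"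
proof -
  let ?adj = "fst (adjacency D F [0..<length D] (\<lambda>_. []))"
  have "routing D A s route \<and>
      (\<forall>j \<in> A. route (fst (D ! j)) \<noteq> None \<longrightarrow> route (snd (D ! j)) \<noteq> None)"
    unfolding route_def search_def fst_bind_comp
  proof (rule routing_explore)
    show "routing D A s ((\<lambda>_. None)(s := Some []))"
      by (auto simp: routing_def)
    show "set (?adj w) = {j \<in> A. fst (D ! j) = w}" for w
      by (auto simp: set_adjacency A_def)
  qed (auto simp: A_def set_adjacency split: if_splits)
  then show "routing D A s route"
    and "j \<in> A \<Longrightarrow> route (fst (D ! j)) \<noteq> None \<Longrightarrow> route (snd (D ! j)) \<noteq> None"
    by auto
qed

lemma search_Some:
  assumes "fst (search D F s) w = Some P"
  shows "dipath D s P w" and "distinct P"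
    and "j \<in> set P \<Longrightarrow> j < length D \<and> (j, D ! j) \<notin> F \<and> snd (D ! j) \<noteq> s"
    and "length P \<le> length D"
proof -
  show *: "dipath D s P w" "distinct P"
    "j \<in> set P \<Longrightarrow> j < length D \<and> (j, D ! j) \<notin> F \<and> snd (D ! j) \<noteq> s" for j
    using search_routing(1)[of D F s] assms unfolding routing_def by blast+
  have "card (set P) \<le> card {..<length D}"
    using *(3) by (intro card_mono) auto
  then show "length P \<le> length D"
    using distinct_card[OF *(2)] by simp
qed

lemma visited_search: "fst (search D F s) s \<noteq> None"
  using search_routing(1)[of D F s] by (simp add: routing_def)

text \<open>Provides the finiteness of the reached set, over which outdegrees are summed
  later.\<close>

lemma visited_subset: "{w. fst (search D F s) w \<noteq> None} \<subseteq> insert s (snd ` set D)"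
proof
  fix w assume "w \<in> {w. fst (search D F s) w \<noteq> None}"
  then obtain P where P: "fst (search D F s) w = Some P" by blast
  then show "w \<in> insert s (snd ` set D)"
    using search_Some(1,3)[OF P] by (cases P) auto
qed

lemma search_closed:
  assumes "j < length D" and "(j, D ! j) \<notin> F" and "fst (search D F s) (fst (D ! j)) \<noteq> None"
  shows "fst (search D F s) (snd (D ! j)) \<noteq> None"
  using search_routing(2)[of j D F s] assms by blast

section \<open>Families of orientations with fixed arcs and given outdegrees\<close>

section \<open>Completions of partial orientations\<close>

text \<open>Comparing outdegrees at all natural numbers spares carrying a vertex set through the
  recursion. \<open>D\<close> only represents its class.\<close>

definition completions :: "orientation \<Rightarrow> arc set \<Rightarrow> orientation set" where
  "completions D F = {D'. reorientation D D' \<and> (\<forall>v. outdegree D' v = outdegree D v) \<and>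
     (\<forall>(j, a) \<in> F. D' ! j = a)}"

lemma completions_insert:
  "completions D (insert (i, a) F) = {D' \<in> completions D F. D' ! i = a}"
  by (auto simp: completions_def)

text \<open>The representative may be exchanged within the family. This lets the second recursive
  call, made on a reversed orientation, be compared with the first.\<close>

lemma completions_eq:
  assumes "D' \<in> completions D F"
  shows "completions D' F = completions D F"
proof -
  have "reorientation D' = reorientation D"
    using assms by (intro reorientation_eq) (simp add: completions_def)
  then show ?thesis using assms by (simp add: completions_def)
qed

lemma completions_all_fixed:
  assumes "\<And>j a. (j, a) \<in> F \<Longrightarrow> D ! j = a" and "\<And>i. i < length D \<Longrightarrow> i \<in> fst ` F"
  shows "completions D F = {D}"
proof (intro equalityI subsetI)
  fix D' assume D': "D' \<in> completions D F"
  have "D' ! i = D ! i" if i: "i < length D" for i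
  proof -
    obtain a where "(i, a) \<in> F" using assms(2)[OF i] by auto
    then show ?thesis using D' assms(1) by (auto simp: completions_def)
  qed
  then show "D' \<in> {D}"
    using D' by (auto simp: completions_def reorientation_def intro: nth_equalityI)
next
  fix D' assume "D' \<in> {D}"
  then show "D' \<in> completions D F"
    using assms(1) by (auto simp: completions_def reorientation_refl)
qed

text \<open>Adding the balance of the path to the effect of reversal leaves one unit of outdegree
  moved from \<open>s\<close> to \<open>t\<close>, or no change if the path is closed.\<close>

lemma outdegree_reverse_dipath:
  assumes "dipath D s P t" and "distinct P" and "set P \<subseteq> {..<length D}"
  shows "outdegree (reverse_arcs P D) x + of_bool (x = s) = outdegree D x + of_bool (x = t)"
  using outdegree_reverse_arcs[OF assms(2,3), of x] dipath_degree_balance[OF assms(1), of x]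
  by linarith

text \<open>Appending \<open>(u, v)\<close> to the path closes it at \<open>v\<close>, so no
  outdegree changes; the search avoids \<open>F\<close> and \<open>i\<close> is free, so fixed arcs
  stay.\<close>

lemma reverse_cycle_in_completions:
  assumes F: "\<And>j a. (j, a) \<in> F \<Longrightarrow> j < length D \<and> D ! j = a"
    and i: "i < length D" "i \<notin> fst ` F" "D ! i = (u, v)"
    and P: "fst (search D F v) u = Some P"
  shows "reverse_arcs (i # P) D \<in> completions D F"
proof -
  note path = search_Some[OF P]
  \<comment> \<open>The search may use \<open>i\<close>, which is not fixed, but its head is the
    start \<open>v\<close>, which no arc of a route enters.\<close>
  have "i \<notin> set P" using path(3)[of i] i(3) by auto
  then have "distinct (i # P)" using path(2) by simp
  moreover have "set (i # P) \<subseteq> {..<length D}" using path(3) i(1) by auto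
  moreover have "dipath D v (i # P) v" using path(1) i(3) by simp
  ultimately have "outdegree (reverse_arcs (i # P) D) x = outdegree D x" for x
    using outdegree_reverse_dipath[of D v "i # P" v x] by simp
  moreover have "reverse_arcs (i # P) D ! j = a" if "(j, a) \<in> F" for j a
  proof -
    have "j \<noteq> i" using that i(2) by force
    moreover have "j \<notin> set P" using that F[OF that] path(3)[of j] by auto
    ultimately have "j \<notin> set (i # P)" by simp
    then show ?thesis using F[OF that] by (simp add: nth_reverse_arcs)
  qed
  ultimately show ?thesis
    using reorientation_reverse_arcs unfolding completions_def by blast
qed

text \<open>Free arcs cannot leave the set \<open>?R\<close> reached from \<open>v\<close>, and
  fixed arcs keep their direction in \<open>D'\<close>, so no tail in \<open>?R\<close> is lost. If
  \<open>u\<close> is not in \<open>?R\<close>, edge \<open>i\<close> adds one, against the equal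
  sums of outdegrees over \<open>?R\<close>.\<close>

lemma reachable_if_completion_reverses:
  assumes D': "D' \<in> completions D F"
    and i: "i < length D" "D ! i = (u, v)" "D' ! i = (v, u)"
  shows "fst (search D F v) u \<noteq> None"
proof
  assume u: "fst (search D F v) u = None"
  let ?R = "{w. fst (search D F v) w \<noteq> None}"
  let ?tails = "\<lambda>D. {j. j < length D \<and> fst (D ! j) \<in> ?R}"
  have "finite ?R" by (rule finite_subset[OF visited_subset]) simp
  have re: "reorientation D D'" and deg: "outdegree D' = outdegree D"
    and F: "(j, a) \<in> F \<Longrightarrow> D' ! j = a" for j a
    using D' by (auto simp: completions_def)
  have "?tails D \<subseteq> ?tails D'"
  proof (rule tails_in_closed_set[OF re])
    fix j assume "j < length D" "fst (D ! j) \<in> ?R"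
    then show "D' ! j = D ! j \<or> snd (D ! j) \<in> ?R"
      using search_closed[of j D F v] F[of j "D ! j"] by blast
  qed
  moreover have "length D' = length D"
    using re by (simp add: reorientation_def)
  then have "i \<in> ?tails D'" "i \<notin> ?tails D"
    using i u visited_search[of D F v] by simp_all
  ultimately have "?tails D \<subset> ?tails D'" by blast
  then have "card (?tails D) < card (?tails D')"
    by (rule psubset_card_mono[rotated]) simp
  then show False
    by (simp only: deg less_irrefl flip: sum_outdegree[OF \<open>finite ?R\<close>])
qed

section \<open>Output set and gaps of the recursive procedure\<close>

section \<open>The enumeration procedure\<close>

definition free_edges :: "orientation \<Rightarrow> arc set \<Rightarrow> nat set" where
  "free_edges D F = {j. j < length D \<and> j \<notin> fst ` F}"

lemma card_free_edges_insert:
  assumes "i \<in> free_edges D F" and "length D' = length D"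
  shows "card (free_edges D' (insert (i, a) F)) < card (free_edges D F)"
  using assms unfolding free_edges_def by (intro psubset_card_mono) auto

abbreviation next_edge :: "orientation \<Rightarrow> arc set \<Rightarrow> nat option comp" where
  "next_edge D F \<equiv> find_first (\<lambda>i. i \<notin> fst ` F) [0..<length D]"

lemma next_edge_Some: "fst (next_edge D F) = Some i \<Longrightarrow> i \<in> free_edges D F"
  using find_first_Some[of "\<lambda>i. i \<notin> fst ` F" "[0..<length D]" i] by (simp add: free_edges_def)

lemma time_next_edge: "length (snd (next_edge D F)) \<le> Suc (length D)"
  using time_find_first[of "\<lambda>i. i \<notin> fst ` F" "[0..<length D]"] by simp

text \<open>Here and in the next two equations the brackets collect the silent stretches around the
  recursive calls, in the shape needed by the gap lemmas.\<close>

lemma snd_enopods_leaf: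
  assumes "fst (next_edge D F) = None"
  shows "snd (enopods D F) = (snd (next_edge D F) @ replicate (length D) Step) @ [Output D]"
  by (subst enopods.simps) (simp add: assms)

lemma snd_enopods_no_cycle:
  assumes "fst (next_edge D F) = Some i" and "D ! i = (u, v)" and "fst (search D F v) u = None"
  shows "snd (enopods D F) =
     (snd (next_edge D F) @ replicate (2 * length D + 1) Step) @
     snd (enopods D (insert (i, u, v) F)) @ [Step] @ snd (search D F v)"
  by (subst enopods.simps) (simp add: assms)

lemma snd_enopods_cycle:
  assumes "fst (next_edge D F) = Some i" and "D ! i = (u, v)" and "fst (search D F v) u = Some P"
  shows "snd (enopods D F) =
     (snd (next_edge D F) @ replicate (2 * length D + 1) Step) @
     snd (enopods D (insert (i, u, v) F)) @
     ([Step] @ snd (search D F v) @ replicate (3 * length D + length P + 1) Step) @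
     snd (enopods (reverse_arcs (i # P) D) (insert (i, v, u) F)) @ [Step]"
  by (subst enopods.simps) (simp add: assms)

text \<open>The induction is on the number of free edges, which drops in both calls. Looplessness is
  carried along because the two directions of a loop coincide, and both calls would then output the
  same orientations.\<close>

lemma outputs_enopods:
  assumes "\<And>j a. (j, a) \<in> F \<Longrightarrow> j < length D \<and> D ! j = a"
    and "\<And>a. a \<in> set D \<Longrightarrow> fst a \<noteq> snd a"
  shows "set (outputs (snd (enopods D F))) = completions D F \<and>
     distinct (outputs (snd (enopods D F)))"
  using assms
proof (induction "card (free_edges D F)" arbitrary: D F rule: less_induct)
  case less
  note F = less.prems(1) and loopless = less.prems(2)
  show ?case
  proof (cases "fst (next_edge D F)")
    case None
    then have "i \<in> fst ` F" if "i < length D" for i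
      using find_first_None[OF None, of i] that by simp
    then show ?thesis
      using completions_all_fixed[where F = F and D = D] F None by (simp add: snd_enopods_leaf)
  next
    case (Some i)
    obtain u v where uv: "D ! i = (u, v)" by fastforce
    from next_edge_Some[OF Some] have free: "i \<in> free_edges D F" .
    then have i: "i < length D" "i \<notin> fst ` F" by (simp_all add: free_edges_def)
    have "u \<noteq> v" using loopless[OF nth_mem[OF i(1)]] uv by simp
    have keep: "set (outputs (snd (enopods D (insert (i, u, v) F)))) =
          completions D (insert (i, u, v) F) \<and>
        distinct (outputs (snd (enopods D (insert (i, u, v) F))))"
      using F i(1) uv loopless
      by (intro less.hyps card_free_edges_insert free refl) auto
    have cases: "D' ! i = (u, v) \<or> D' ! i = (v, u)" if "D' \<in> completions D F" for D'
      using that i(1) uv by (auto simp: completions_def reorientation_def)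
    show ?thesis
    proof (cases "fst (search D F v) u")
      case None
      \<comment> \<open>A completion with \<open>i\<close> reversed would make \<open>u\<close>
        reachable from \<open>v\<close>.\<close>
      have "completions D F = completions D (insert (i, u, v) F)"
        using cases reachable_if_completion_reverses[OF _ i(1) uv] None
        unfolding completions_insert by blast
      then show ?thesis
        using keep by (simp add: snd_enopods_no_cycle[OF Some uv None])
    next
      case P: (Some P)
      let ?D = "reverse_arcs (i # P) D"
      have mem: "?D \<in> completions D F"
        using reverse_cycle_in_completions[OF F i uv P] .
      have nth: "?D ! i = (v, u)" using i(1) uv by (simp add: nth_reverse_arcs)
      have "fst a \<noteq> snd a" if "a \<in> set ?D" for a
      proof -
        obtain j where "j < length D" "a = ?D ! j"
          using \<open>a \<in> set ?D\<close> by (auto simp: in_set_conv_nth)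
        then show ?thesis
          using loopless[of "D ! j"] by (auto simp: nth_reverse_arcs)
      qed
      moreover have "j < length ?D \<and> ?D ! j = a" if "(j, a) \<in> insert (i, v, u) F" for j a
        using that F[of j a] mem i(1) nth by (auto simp: completions_def)
      ultimately have reverse: "set (outputs (snd (enopods ?D (insert (i, v, u) F)))) =
            completions ?D (insert (i, v, u) F) \<and>
          distinct (outputs (snd (enopods ?D (insert (i, v, u) F))))"
        by (intro less.hyps card_free_edges_insert free length_reverse_arcs)
      \<comment> \<open>With \<open>?D\<close> replaced by \<open>D\<close> as representative, the
        two families are told apart by the direction of \<open>i\<close> alone.\<close>
      have "completions D F =
          completions D (insert (i, u, v) F) \<union> completions ?D (insert (i, v, u) F)"
        using cases unfolding completions_insert completions_eq[OF mem] by blast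
      moreover have "completions D (insert (i, u, v) F) \<inter> completions ?D (insert (i, v, u) F) = {}"
        using \<open>u \<noteq> v\<close> unfolding completions_insert by auto
      ultimately show ?thesis
        using keep reverse by (simp add: snd_enopods_cycle[OF Some uv P])
    qed
  qed
qed

text \<open>
  Every call outputs something. So at most one branch of the recursion tree, of length at most the
  number of free edges, is descended before the first output of a call or climbed after the last.
\<close>

lemma gap_bounded_enopods:
  assumes "n = card (free_edges D F)" and "K = 16 * (length D + 1)"
  shows "gap_bounded ((n + 1) * K) ((n + 1) * K) ((2 * n + 2) * K) (snd (enopods D F))"
  using assms
proof (induction n arbitrary: D F rule: less_induct)
  case (less n)
  let ?m = "length D"
  have K: "K = 16 * ?m + 16" using less.prems(2) by simp
  \<comment> \<open>Expanded so that \<open>n * K\<close> is an atom for linear arithmetic.\<close>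
  have bounds: "(n + 1) * K = n * K + K" "(2 * n + 2) * K = 2 * (n * K) + 2 * K"
    by (simp_all add: algebra_simps)
  \<comment> \<open>A subcall has fewer than \<open>n\<close> free edges, which saves one
    \<open>K\<close> in each outer gap and two in the inner bound. This is the allowance for the
    work of the present call.\<close>
  have call: "gap_bounded (n * K) (n * K) (2 * (n * K)) (snd (enopods D' (insert (i, a) F)))"
    if "i \<in> free_edges D F" "length D' = ?m" for D' i a
  proof -
    let ?n = "card (free_edges D' (insert (i, a) F))"
    have "?n < n"
      using card_free_edges_insert[OF that] less.prems(1) by simp
    moreover from this have "(?n + 1) * K \<le> n * K" by (intro mult_right_mono) auto
    moreover from this have "(2 * ?n + 2) * K \<le> 2 * (n * K)" by (simp add: algebra_simps)
    ultimately show ?thesis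
      using gap_bounded_mono[OF less.IH[OF _ refl]] that(2) less.prems(2) by simp
  qed
  show ?case
  proof (cases "fst (next_edge D F)")
    case None
    show ?thesis
      unfolding snd_enopods_leaf[OF None] bounds
      by (rule gap_bounded_prepend[OF _ gap_bounded_mono[OF gap_bounded_Output, of 0]])
        (use time_next_edge[of F D] K in auto)
  next
    case (Some i)
    obtain u v where uv: "D ! i = (u, v)" by fastforce
    from next_edge_Some[OF Some] have free: "i \<in> free_edges D F" .
    show ?thesis
    proof (cases "fst (search D F v) u")
      case None
      show ?thesis
        unfolding snd_enopods_no_cycle[OF Some uv None] bounds
        by (rule gap_bounded_prepend[OF _
              gap_bounded_postpend[OF _ call[OF free refl], where d = "2 * (n * K) + 2 * K"]])
          (use time_next_edge[of F D] time_search[of D F v] K in auto)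
    next
      case P: (Some P)
      let ?D = "reverse_arcs (i # P) D"
      \<comment> \<open>Between the two calls lie one step, a search of at most
        \<open>9 * ?m + 4\<close> and a reversal of at most \<open>4 * ?m + 1\<close>. The gap there
        is at most \<open>2 * (n * K) + K\<close>.\<close>
      have "gap_bounded (n * K + (14 * ?m + 6)) (n * K + K) (2 * (n * K) + 2 * K)
          (([Step] @ snd (search D F v) @ replicate (3 * ?m + length P + 1) Step) @
           snd (enopods ?D (insert (i, v, u) F)) @ [Step])"
        by (rule gap_bounded_prepend[OF _
              gap_bounded_postpend[OF _ call[OF free length_reverse_arcs],
                where d = "2 * (n * K) + 2 * K"]])
          (use time_search[of D F v] search_Some(4)[OF P] K in auto)
      then have "gap_bounded (n * K) (n * K + K) (2 * (n * K) + 2 * K)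
          (snd (enopods D (insert (i, u, v) F)) @
           ([Step] @ snd (search D F v) @ replicate (3 * ?m + length P + 1) Step) @
           snd (enopods ?D (insert (i, v, u) F)) @ [Step])"
        by (rule gap_bounded_append[OF call[OF free refl]]) (use K in auto)
      then show ?thesis
        unfolding snd_enopods_cycle[OF Some uv P] bounds
        by (rule gap_bounded_prepend[rotated])
          (use time_next_edge[of F D] K in auto)
    qed
  qed
qed

section \<open>Correctness and quadratic time of the flow computation\<close>

section \<open>The initial orientation\<close>

lemma fst_count_out:
  "fst (count_out D d) v = d v + outdegree D v"
proof (induction D arbitrary: d)
  case (Cons a D)
  \<comment> \<open>Written as the length of a filtered list, the count is insensitive to the index
    shift.\<close>
  have "outdegree (a # D) v = of_bool (fst a = v) + outdegree D v"
    unfolding outdegree_def length_filter_conv_card[of "\<lambda>a. fst a = v", symmetric] by simp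
  with Cons show ?case by simp
qed (simp add: outdegree_def)

lemma outputs_count_out [simp]: "outputs (snd (count_out D d)) = []"
  and time_count_out: "length (snd (count_out D d)) = length D"
  by (induction D arbitrary: d) auto

definition endpoints :: "orientation \<Rightarrow> nat set" where
  "endpoints D = fst ` set D \<union> snd ` set D"

lemma in_endpoints_iff:
  "w \<in> endpoints D \<longleftrightarrow> (\<exists>j < length D. w = fst (D ! j) \<or> w = snd (D ! j))"
  unfolding endpoints_def set_conv_nth by auto

lemma endpoints_reorientation:
  assumes "reorientation D D'"
  shows "endpoints D' = endpoints D"
proof -
  have "endpoints D' \<subseteq> endpoints D" if re: "reorientation D D'" for D D'
  proof
    fix w assume "w \<in> endpoints D'"
    then obtain j where "j < length D'" "w = fst (D' ! j) \<or> w = snd (D' ! j)"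
      unfolding in_endpoints_iff by blast
    moreover from this have "j < length D" "D' ! j = D ! j \<or> D' ! j = prod.swap (D ! j)"
      using re by (simp_all add: reorientation_def)
    ultimately have "w = fst (D ! j) \<or> w = snd (D ! j)" by auto
    with \<open>j < length D\<close> show "w \<in> endpoints D" unfolding in_endpoints_iff by blast
  qed
  from this[OF assms] this[OF reorientation_sym[OF assms]] show ?thesis by (rule equalityI)
qed

lemma outdegree_not_endpoint:
  assumes "v \<notin> endpoints D"
  shows "outdegree D v = 0"
proof -
  have "{i. i < length D \<and> fst (D ! i) = v} = {}"
    using assms unfolding in_endpoints_iff by blast
  then show ?thesis by (simp add: outdegree_def)
qed

lemma sum_outdegree_endpoints:
  assumes "finite V" and "endpoints D \<subseteq> V"
  shows "(\<Sum>v\<in>V. outdegree D v) = length D"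
proof -
  have "fst (D ! i) \<in> V" if "i < length D" for i
    using assms(2) that in_endpoints_iff by blast
  then have "{i. i < length D \<and> fst (D ! i) \<in> V} = {..<length D}" by blast
  then show ?thesis by (simp add: sum_outdegree[OF assms(1)])
qed

definition realizes :: "nat set \<Rightarrow> (nat \<Rightarrow> nat) \<Rightarrow> orientation \<Rightarrow> bool" where
  "realizes V \<alpha> D \<longleftrightarrow> (\<forall>v\<in>V. outdegree D v = \<alpha> v)"

text \<open>Every reorientation has total outdegree \<open>length D\<close>, whereas
  \<open>\<alpha>\<close> adds up to more.\<close>

lemma no_realization_if_deficient:
  assumes "endpoints D \<subseteq> V" and "finite V"
    and "\<And>v. v \<in> V \<Longrightarrow> outdegree D v \<le> \<alpha> v" and "t \<in> V" and "outdegree D t < \<alpha> t"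
    and "reorientation D D'"
  shows "\<not> realizes V \<alpha> D'"
proof
  assume "realizes V \<alpha> D'"
  have "(\<Sum>v\<in>V. outdegree D v) < (\<Sum>v\<in>V. \<alpha> v)"
    using assms by (intro sum_strict_mono_ex1) auto
  also have "\<dots> = (\<Sum>v\<in>V. outdegree D' v)"
    using \<open>realizes V \<alpha> D'\<close> by (simp add: realizes_def)
  also have "\<dots> = length D"
    using assms(1,2,6) endpoints_reorientation[OF assms(6)]
    by (simp add: sum_outdegree_endpoints reorientation_def)
  finally show False
    using assms(1,2) by (simp add: sum_outdegree_endpoints)
qed

text \<open>The set reached from \<open>s\<close> is closed in \<open>D\<close>, so no reorientation
  has fewer tails in it. But \<open>\<alpha>\<close> asks for fewer: no vertex of the set is
  deficient and \<open>s\<close> has excess.\<close>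

lemma no_realization_if_no_sink:
  assumes "s \<in> V" and "endpoints D \<subseteq> V" and "\<alpha> s < outdegree D s"
    and sink: "\<And>t. t \<in> V \<Longrightarrow> fst (search D {} s) t \<noteq> None \<Longrightarrow> \<alpha> t \<le> outdegree D t"
    and "reorientation D D'"
  shows "\<not> realizes V \<alpha> D'"
proof
  assume real: "realizes V \<alpha> D'"
  let ?R = "{w. fst (search D {} s) w \<noteq> None}"
  have R: "?R \<subseteq> V" "finite ?R" "s \<in> ?R"
  proof -
    have "insert s (snd ` set D) \<subseteq> V" using assms(1,2) by (simp add: endpoints_def)
    then show "?R \<subseteq> V" using visited_subset by (rule order_trans[rotated])
    show "finite ?R" by (rule finite_subset[OF visited_subset]) simp
    show "s \<in> ?R" using visited_search by simp
  qed
  have "(\<Sum>v\<in>?R. outdegree D' v) = (\<Sum>v\<in>?R. \<alpha> v)"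
    using real R(1) by (intro sum.cong refl) (auto simp: realizes_def)
  also have "\<dots> < (\<Sum>v\<in>?R. outdegree D v)"
    using R sink assms(3) by (intro sum_strict_mono_ex1) blast+
  also have "\<dots> \<le> (\<Sum>v\<in>?R. outdegree D' v)"
    unfolding sum_outdegree[OF R(2)]
  proof (intro card_mono tails_in_closed_set[OF assms(5)])
    show "D' ! j = D ! j \<or> snd (D ! j) \<in> ?R" if "j < length D" "fst (D ! j) \<in> ?R" for j
      using search_closed[of j D "{}" s] that by simp
  qed simp
  finally show False by simp
qed

text \<open>The truncated subtraction is the positive part of \<open>outdegree D v - \<alpha> v\<close>.\<close>

definition excess :: "nat set \<Rightarrow> (nat \<Rightarrow> nat) \<Rightarrow> orientation \<Rightarrow> nat" where
  "excess V \<alpha> D = (\<Sum>v\<in>V. outdegree D v - \<alpha> v)"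

text \<open>The unit taken from \<open>s\<close> lowers its excess; the deficient \<open>t\<close>
  absorbs it without acquiring any.\<close>

lemma excess_reverse_arcs:
  assumes "finite V" and "s \<in> V" and "\<alpha> s < outdegree D s" and "outdegree D t < \<alpha> t"
    and P: "fst (search D {} s) t = Some P"
  shows "excess V \<alpha> (reverse_arcs P D) < excess V \<alpha> D"
proof -
  note path = search_Some[OF P]
  have set: "set P \<subseteq> {..<length D}" using path(3) by auto
  have degree: "outdegree (reverse_arcs P D) x + of_bool (x = s) = outdegree D x + of_bool (x = t)"
    for x using outdegree_reverse_dipath[OF path(1,2) set] .
  have "outdegree (reverse_arcs P D) x - \<alpha> x \<le> outdegree D x - \<alpha> x" for x
    using degree[of x] assms(4) by (auto simp: of_bool_def split: if_splits)
  moreover have "outdegree (reverse_arcs P D) s - \<alpha> s < outdegree D s - \<alpha> s"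
    using degree[of s] assms(3,4) by (auto simp: of_bool_def split: if_splits)
  ultimately show ?thesis
    unfolding excess_def using assms(1,2) by (intro sum_strict_mono_ex1) auto
qed

text \<open>Each round lowers the excess, so the rounds cannot run out and \<open>None\<close> is
  conclusive. The base case is vacuous.\<close>

lemma augment_correct:
  assumes "finite V" and "endpoints D \<subseteq> V" and "\<And>v. v \<in> V \<Longrightarrow> v \<notin> endpoints D \<Longrightarrow> \<alpha> v = 0"
    and "excess V \<alpha> D < k"
  shows "case fst (augment k \<alpha> D) of
      None \<Rightarrow> \<not> (\<exists>D'. reorientation D D' \<and> realizes V \<alpha> D')
    | Some D' \<Rightarrow> reorientation D D' \<and> realizes V \<alpha> D'"
  using assms(2-4)
proof (induction k arbitrary: D)
  case (Suc k)
  let ?vs = "map fst D @ map snd D" and ?d = "fst (count_out D (\<lambda>_. 0))"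
  let ?source = "fst (find_first (\<lambda>v. \<alpha> v < ?d v) ?vs)"
  let ?deficient = "fst (find_first (\<lambda>v. ?d v < \<alpha> v) ?vs)"
  have d: "?d = outdegree D" by (rule ext) (simp add: fst_count_out)
  have vs: "set ?vs = endpoints D" by (simp add: endpoints_def)
  \<comment> \<open>The scans see endpoints only. At any other vertex both numbers are 0, so it is
    neither a source nor a sink.\<close>
  have isolated: "outdegree D v = 0" "\<alpha> v = 0" if "v \<in> V" "v \<notin> endpoints D" for v
    using that Suc.prems(2) outdegree_not_endpoint by auto
  show ?case
  proof (cases ?source)
    case None
    have le: "outdegree D v \<le> \<alpha> v" if "v \<in> V" for v
      using find_first_None[OF None, of v] isolated[OF that] unfolding d vs by fastforce
    show ?thesis
    proof (cases ?deficient)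
      case None': None
      have "\<alpha> v \<le> outdegree D v" if "v \<in> V" for v
        using find_first_None[OF None', of v] isolated[OF that] unfolding d vs by fastforce
      then have "realizes V \<alpha> D" using le by (simp add: realizes_def eq_iff)
      then show ?thesis using None None' by (simp add: Let_def reorientation_refl)
    next
      case (Some t)
      then have "t \<in> V" "outdegree D t < \<alpha> t"
        using find_first_Some[OF Some] Suc.prems(1) unfolding d vs by auto
      then show ?thesis
        using None Some no_realization_if_deficient[OF Suc.prems(1) assms(1) le]
        by (auto simp: Let_def)
    qed
  next
    case s: (Some s)
    then have s': "s \<in> V" "\<alpha> s < outdegree D s"
      using find_first_Some[OF s] Suc.prems(1) unfolding d vs by auto
    let ?route = "fst (search D {} s)"
    let ?sink = "fst (find_first (\<lambda>t. ?d t < \<alpha> t \<and> ?route t \<noteq> None) ?vs)"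
    show ?thesis
    proof (cases ?sink)
      case None
      have "\<alpha> t \<le> outdegree D t" if "t \<in> V" "?route t \<noteq> None" for t
        using find_first_None[OF None, of t] isolated[OF that(1)] that(2)
        unfolding d vs by fastforce
      from no_realization_if_no_sink[where \<alpha> = \<alpha>, OF s'(1) Suc.prems(1) s'(2) this]
      show ?thesis using s None by (auto simp: Let_def)
    next
      case t: (Some t)
      then have "outdegree D t < \<alpha> t" "?route t \<noteq> None"
        using find_first_Some[OF t] unfolding d by auto
      then obtain P where P: "?route t = Some P" by blast
      let ?D = "reverse_arcs P D"
      have re: "reorientation D ?D" by (rule reorientation_reverse_arcs)
      have "excess V \<alpha> ?D < k"
        using excess_reverse_arcs[OF assms(1) s' \<open>outdegree D t < \<alpha> t\<close> P] Suc.prems(3) by simp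
      note IH = Suc.IH[of ?D, unfolded endpoints_reorientation[OF re], OF Suc.prems(1,2) this]
      have "fst (augment (Suc k) \<alpha> D) = fst (augment k \<alpha> ?D)"
        using s t P by (simp add: Let_def)
      moreover have "reorientation D = reorientation ?D"
        by (rule reorientation_eq[OF re, symmetric])
      ultimately show ?thesis using IH by (simp del: augment.simps split: option.splits)
    qed
  qed
qed simp

lemma outputs_augment [simp]: "outputs (snd (augment k \<alpha> D)) = []"
  by (induction k arbitrary: D) (auto simp: Let_def split: option.splits)

text \<open>With \<open>m = length D\<close>, a round costs \<open>2 * m\<close> at its start,
  \<open>m\<close> for counting, two scans of \<open>2 * m + 1\<close>, a search of
  \<open>9 * m + 4\<close> and a reversal of at most \<open>3 * m\<close>.\<close>

lemma time_augment: "length (snd (augment k \<alpha> D)) \<le> k * (19 * length D + 6)"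
proof (induction k arbitrary: D)
  case (Suc k)
  let ?m = "length D"
  have find: "length (snd (find_first Q (map fst D @ map snd D))) \<le> 2 * ?m + 1" for Q
    using time_find_first[of Q "map fst D @ map snd D"] by simp
  have IH: "length (snd (augment k \<alpha> (reverse_arcs P D))) \<le> k * (19 * ?m + 6)" for P
    using Suc[of "reverse_arcs P D"] by simp
  let ?d = "fst (count_out D (\<lambda>_. 0))" and ?vs = "map fst D @ map snd D"
  let ?source = "find_first (\<lambda>v. \<alpha> v < ?d v) ?vs"
  show ?case
  proof (cases "fst ?source")
    case None
    then show ?thesis
      using find[of "\<lambda>v. \<alpha> v < ?d v"] find[of "\<lambda>v. ?d v < \<alpha> v"] by (simp add: Let_def time_count_out)
  next
    case s: (Some s)
    let ?Q = "\<lambda>t. ?d t < \<alpha> t \<and> fst (search D {} s) t \<noteq> None"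
    note bounds = find[of "\<lambda>v. \<alpha> v < ?d v"] find[of ?Q] time_search[of D "{}" s]
    show ?thesis
    proof (cases "fst (find_first ?Q ?vs)")
      case None
      then show ?thesis using s bounds by (simp add: Let_def time_count_out)
    next
      case t: (Some t)
      then obtain P where P: "fst (search D {} s) t = Some P"
        using find_first_Some[OF t] by blast
      then show ?thesis
        using s t bounds IH[of P] search_Some(4)[OF P] by (simp add: Let_def time_count_out)
    qed
  qed
qed simp

section \<open>Assembly of the enumeration and the delay bound\<close>

section \<open>The enumeration algorithm\<close>

lemma alpha_orientation_iff:
  "alpha_orientation G \<alpha> D \<longleftrightarrow> reorientation (ends G) D \<and> realizes {..<num_verts G} \<alpha> D"
  by (auto simp: alpha_orientation_def is_orientation_iff realizes_def)

lemma endpoints_subset_verts: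
  "loopless_multigraph G \<Longrightarrow> endpoints (ends G) \<subseteq> {..<num_verts G}"
  by (auto simp: loopless_multigraph_def endpoints_def)

lemma find_alpha_orientation_correct:
  assumes "loopless_multigraph G"
  shows "case fst (find_alpha_orientation G \<alpha>) of
      None \<Rightarrow> \<not> (\<exists>D. alpha_orientation G \<alpha> D)
    | Some D \<Rightarrow> alpha_orientation G \<alpha> D"
proof -
  let ?V = "{..<num_verts G}"
  let ?isolated = "\<lambda>v. v \<notin> fst ` set (ends G) \<union> snd ` set (ends G) \<and> \<alpha> v \<noteq> 0"
  let ?bad = "fst (find_first ?isolated [0..<num_verts G])"
  show ?thesis
  proof (cases ?bad)
    case None
    have "\<alpha> v = 0" if "v \<in> ?V" "v \<notin> endpoints (ends G)" for v
      using find_first_None[OF None, of v] that by (simp add: endpoints_def)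
    \<comment> \<open>The initial excess is at most the total outdegree, which is the number of
      edges; hence one more round than edges suffices.\<close>
    moreover have "excess ?V \<alpha> (ends G) \<le> (\<Sum>v\<in>?V. outdegree (ends G) v)"
      unfolding excess_def by (rule sum_mono) simp
    then have "excess ?V \<alpha> (ends G) < Suc (num_edges G)"
      using endpoints_subset_verts[OF assms]
      by (simp add: sum_outdegree_endpoints num_edges_def)
    ultimately show ?thesis
      using augment_correct[OF _ endpoints_subset_verts[OF assms], of \<alpha> "Suc (num_edges G)"] None
      by (simp add: find_alpha_orientation_def alpha_orientation_iff
          del: augment.simps split: option.splits)
  next
    case (Some v)
    then have v: "v < num_verts G" "v \<notin> endpoints (ends G)" "\<alpha> v \<noteq> 0"
      using find_first_Some[OF Some] by (auto simp: endpoints_def)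
    have "\<not> alpha_orientation G \<alpha> D" for D
    proof
      assume "alpha_orientation G \<alpha> D"
      then have "v \<notin> endpoints D" and "outdegree D v = \<alpha> v"
        using v endpoints_reorientation[of "ends G" D]
        by (simp_all add: alpha_orientation_iff realizes_def)
      then show False using v(3) outdegree_not_endpoint by simp
    qed
    then show ?thesis using Some by (simp add: find_alpha_orientation_def)
  qed
qed

lemma outputs_find_alpha_orientation [simp]: "outputs (snd (find_alpha_orientation G \<alpha>)) = []"
  by (simp add: find_alpha_orientation_def split: option.split del: augment.simps)

lemma time_find_alpha_orientation:
  "length (snd (find_alpha_orientation G \<alpha>))
     \<le> 2 * num_verts G + 3 * num_edges G + 1 + (num_edges G + 1) * (19 * num_edges G + 6)"
  using time_find_first[of "\<lambda>v. v \<notin> fst ` set (ends G) \<union> snd ` set (ends G) \<and> \<alpha> v \<noteq> 0" "[0..<num_verts G]"]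
    time_augment[of "Suc (num_edges G)" \<alpha> "ends G"]
  by (simp add: find_alpha_orientation_def num_edges_def split: option.split del: augment.simps)

lemma outputs_enumerate:
  assumes "loopless_multigraph G"
  shows "set (outputs (snd (enumerate_alpha_orientations G \<alpha>))) = {D. alpha_orientation G \<alpha> D}"
    and "distinct (outputs (snd (enumerate_alpha_orientations G \<alpha>)))"
proof -
  note start = find_alpha_orientation_correct[OF assms, of \<alpha>]
  have "set (outputs (snd (enumerate_alpha_orientations G \<alpha>))) = {D. alpha_orientation G \<alpha> D} \<and>
    distinct (outputs (snd (enumerate_alpha_orientations G \<alpha>)))"
  proof (cases "fst (find_alpha_orientation G \<alpha>)")
    case None
    then show ?thesis using start by (simp add: enumerate_alpha_orientations_def)
  next
    case (Some D)
    then have D: "reorientation (ends G) D" "realizes {..<num_verts G} \<alpha> D"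
      using start by (simp_all add: alpha_orientation_iff)
    have "fst a \<noteq> snd a" if "a \<in> set D" for a
    proof -
      obtain j where "j < length D" "a = D ! j"
        using \<open>a \<in> set D\<close> by (auto simp: in_set_conv_nth)
      then have "j < length (ends G)" "a = ends G ! j \<or> a = prod.swap (ends G ! j)"
        using D(1) by (auto simp: reorientation_def)
      moreover have "fst e \<noteq> snd e" if "e \<in> set (ends G)" for e
        using assms that by (auto simp: loopless_multigraph_def)
      ultimately show ?thesis using nth_mem[of j "ends G"] by fastforce
    qed
    then have "set (outputs (snd (enopods D {}))) = completions D {} \<and>
        distinct (outputs (snd (enopods D {})))"
      by (intro outputs_enopods) auto
    moreover have "completions D {} = {D'. alpha_orientation G \<alpha> D'}"
    proof -
      \<comment> \<open>Completions compare outdegrees at all numbers, \<open>realizes\<close> only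
        at vertices; beyond these both outdegrees are 0.\<close>
      have "(\<forall>v. outdegree D' v = outdegree D v) \<longleftrightarrow> realizes {..<num_verts G} \<alpha> D'"
        if "reorientation (ends G) D'" for D'
      proof -
        have "outdegree D v = 0" "outdegree D' v = 0" if "\<not> v < num_verts G" for v
          using that D(1) \<open>reorientation (ends G) D'\<close> endpoints_subset_verts[OF assms]
          by (auto intro!: outdegree_not_endpoint simp: endpoints_reorientation)
        then show ?thesis using D(2) unfolding realizes_def by (metis lessThan_iff)
      qed
      moreover have "reorientation D = reorientation (ends G)"
        by (rule reorientation_eq[OF D(1)])
      ultimately show ?thesis by (auto simp: completions_def alpha_orientation_iff)
    qed
    ultimately show ?thesis
      using Some by (simp add: enumerate_alpha_orientations_def)
  qed
  then show "set (outputs (snd (enumerate_alpha_orientations G \<alpha>))) = {D. alpha_orientation G \<alpha> D}"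
    and "distinct (outputs (snd (enumerate_alpha_orientations G \<alpha>)))"
    by simp_all
qed

lemma delay_enumerate:
  assumes "loopless_multigraph G"
  shows "delay (snd (enumerate_alpha_orientations G \<alpha>)) \<le> 2 * num_verts G + 54 * (num_edges G + 1)\<^sup>2"
proof -
  let ?m = "num_edges G" and ?start = "find_alpha_orientation G \<alpha>"
  have square: "(Suc ?m)\<^sup>2 = ?m * ?m + 2 * ?m + 1"
    by (simp add: power2_eq_square)
  have start: "length (snd ?start) \<le> 2 * num_verts G + 19 * (?m * ?m) + 28 * ?m + 7"
    using time_find_alpha_orientation[of G \<alpha>] by (simp add: algebra_simps)
  show ?thesis
  proof (cases "fst ?start")
    case None
    then show ?thesis
      using start by (simp add: enumerate_alpha_orientations_def delay_silent square)
  next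
    case (Some D)
    then have "length D = ?m"
      using find_alpha_orientation_correct[OF assms, of \<alpha>]
      by (simp add: alpha_orientation_def is_orientation_def)
    then have "card (free_edges D {}) = ?m"
      by (simp add: free_edges_def)
    with \<open>length D = ?m\<close> gap_bounded_enopods[OF refl refl, of D "{}"]
    have "gap_bounded ((?m + 1) * (16 * (?m + 1))) ((?m + 1) * (16 * (?m + 1)))
        ((2 * ?m + 2) * (16 * (?m + 1))) (snd (enopods D {}))"
      by simp
    \<comment> \<open>The first gap takes in the flow computation, one step and the first descent,
      whose bound is \<open>16 * (?m + 1)\<^sup>2\<close>; all other gaps are at most
      \<open>32 * (?m + 1)\<^sup>2\<close>. The constant 54 covers both cases.\<close>
    then have "gap_bounded (2 * num_verts G + 54 * (?m + 1)\<^sup>2) ((?m + 1) * (16 * (?m + 1)))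
        (2 * num_verts G + 54 * (?m + 1)\<^sup>2) ((snd ?start @ [Step]) @ snd (enopods D {}))"
      by (rule gap_bounded_prepend[rotated])
        (use start in \<open>simp_all add: square algebra_simps\<close>)
    then show ?thesis
      using Some gap_bounded_delay by (simp add: enumerate_alpha_orientations_def)
  qed
qed

lemma num_verts_le:
  assumes "no_isolated_vertex G"
  shows "num_verts G \<le> 2 * num_edges G"
proof -
  have "{..<num_verts G} \<subseteq> set (map fst (ends G) @ map snd (ends G))"
    using assms unfolding no_isolated_vertex_def by force
  then have "card {..<num_verts G} \<le> length (map fst (ends G) @ map snd (ends G))"
    by (meson card_length card_mono finite_set order_trans)
  then show ?thesis by (simp add: num_edges_def)
qed

theorem theorem3:
  "\<exists>C :: nat. \<forall>(G :: multigraph) (\<alpha> :: nat \<Rightarrow> nat). loopless_multigraph G \<longrightarrow>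
     (let tr = snd (enumerate_alpha_orientations G \<alpha>) in
        set (outputs tr) = {D. alpha_orientation G \<alpha> D} \<and> distinct (outputs tr) \<and>
        (num_edges G > 0 \<and> no_isolated_vertex G \<longrightarrow> delay tr \<le> C * num_edges G ^ 2) \<and>
        delay tr \<le> C * (num_edges G ^ 2 + num_verts G + 1))"
proof (intro exI[of _ 220] allI impI)
  fix G :: multigraph and \<alpha> :: "nat \<Rightarrow> nat"
  assume G: "loopless_multigraph G"
  let ?m = "num_edges G" and ?tr = "snd (enumerate_alpha_orientations G \<alpha>)"
  have square: "?m \<le> ?m\<^sup>2" by (simp add: power2_eq_square)
  have delay: "delay ?tr \<le> 2 * num_verts G + 54 * (?m\<^sup>2 + 2 * ?m + 1)"
    using delay_enumerate[OF G, of \<alpha>] by (simp add: power2_eq_square)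
  \<comment> \<open>Generalizing the square to \<open>q\<close> leaves linear arithmetic.\<close>
  have "2 * n + 54 * (q + 2 * k + 1) \<le> 220 * (q + n + 1)" if "k \<le> q" for k n q :: nat
    using that by simp
  from order_trans[OF delay this[OF square]]
  have "delay ?tr \<le> 220 * (?m\<^sup>2 + num_verts G + 1)" .
  moreover have "delay ?tr \<le> 220 * ?m\<^sup>2" if "?m > 0" "no_isolated_vertex G"
  proof -
    \<comment> \<open>Source of the constant: \<open>2 * n\<close> is at most \<open>4 * q\<close>,
      and \<open>q + 2 * k + 1\<close> is at most \<open>4 * q\<close>, so the sum is at most
      \<open>(4 + 216) * q\<close>.\<close>
    have "2 * n + 54 * (q + 2 * k + 1) \<le> 220 * q" if "k \<le> q" "n \<le> 2 * k" "k > 0" for k n q :: nat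
      using that by simp
    from order_trans[OF delay this[OF square num_verts_le[OF that(2)] that(1)]] show ?thesis .
  qed
  ultimately show "let tr = ?tr in
        set (outputs tr) = {D. alpha_orientation G \<alpha> D} \<and> distinct (outputs tr) \<and>
        (?m > 0 \<and> no_isolated_vertex G \<longrightarrow> delay tr \<le> 220 * ?m ^ 2) \<and>
        delay tr \<le> 220 * (?m ^ 2 + num_verts G + 1)"
    using outputs_enumerate[OF G] by (simp add: Let_def)
qed

end
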